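(* Let $(E,d)$ be a metric space and, for $s\in[0,+\infty)$, let $\mathcal{H}^s$ be the Hausdorff measure on $E$. (i) The Hausdorff measure is translation invariant: for all $s\in[0,+\infty)$, all $A\subset E$ and all $x\in E$, $\mathcal{H}^s(A+x)=\mathcal{H}^s(A)$. (ii) The Hausdorff measure satisfies the following scaling property: $$\mathcal{H}^s(\lambda A)=\lambda^s\,\mathcal{H}^s(A),\qquad \forall s\in[0,+\infty),\ \forall A\subset E,\ \forall \lambda>0.$$
   Context: $A+x=\{a+x: a\in A\}$ and $\lambda A=\{\lambda a: a\in A\}$, the sums $a+x$ and multiples $\lambda a$ being taken in $E$. Hausdorff measure on a metric space $(E,d)$: for $A\subset E$, $s\ge 0$ and $\epsilon>0$, let $\mathcal{R}_\epsilon(A)$ be the set of countable coverings of $A$ by subsets $X\subset E$ with $\mathrm{diam}(X)\le\epsilon$, and put $$\mathcal{H}^s_\epsilon(A)=\inf_{D\in\mathcal{R}_\epsilon(A)}\sum_{X\in D}(\mathrm{diam}(X))^s\quad(\inf\varnothing=+\infty),\qquad \mathcal{H}^s(A)=\lim_{\epsilon\to0}\mathcal{H}^s_\epsilon(A)=\sup_{\epsilon>0}\mathcal{H}^s_\epsilon(A).$$ The empty set always contributes $0$ to the sum; for $s=0$ each nonempty $X$ contributes $1$.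
   Formalization: E is taken to be a real vector space with a metric; (i) assumes d(a+x,b+x)=d(a,b), and (ii) assumes d(λa,λb)=λd(a,b) for all λ>0; without these the claims fail, e.g. for d(x,y)=|x³−y³| on the real line with s=1. *)

theory Defs
  imports "HOL-Analysis.Analysis"
begin

text \<open>
  For unbounded sets the real-valued \<^const>\<open>diameter\<close> is unspecified, so the condition
  $\mathrm{diam}(X) \le \epsilon$ is rendered with an explicit boundedness requirement.
\<close>

definition fine_covers :: "real \<Rightarrow> 'a::metric_space set \<Rightarrow> 'a set set set" where
  "fine_covers \<epsilon> A =
     {D. countable D \<and> A \<subseteq> \<Union>D \<and> (\<forall>X\<in>D. bounded X \<and> diameter X \<le> \<epsilon>)}"

text \<open>
  The empty set has weight 0 for every exponent, and a nonempty set has weight 1 for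
  exponent 0. The latter needs a separate case because \<^term>\<open>0 powr 0 = (0::real)\<close>.
\<close>

definition diam_power :: "real \<Rightarrow> 'a::metric_space set \<Rightarrow> ennreal" where
  "diam_power s X =
     (if X = {} then 0 else if s = 0 then 1 else ennreal (diameter X powr s))"

definition hausdorff_pre :: "real \<Rightarrow> real \<Rightarrow> 'a::metric_space set \<Rightarrow> ennreal" where
  "hausdorff_pre s \<epsilon> A = (INF D\<in>fine_covers \<epsilon> A. \<Sum>\<^sub>\<infinity>X\<in>D. diam_power s X)"

definition hausdorff :: "real \<Rightarrow> 'a::metric_space set \<Rightarrow> ennreal" where
  "hausdorff s A = (SUP \<epsilon>\<in>{0<..}. hausdorff_pre s \<epsilon> A)"

lemma hausdorff_pre_antimono:
  assumes "\<epsilon> \<le> \<delta>"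
  shows "hausdorff_pre s \<delta> A \<le> hausdorff_pre s \<epsilon> A"
proof -
  have "fine_covers \<epsilon> A \<subseteq> fine_covers \<delta> A"
    using assms by (force simp: fine_covers_def)
  then show ?thesis
    unfolding hausdorff_pre_def by (rule INF_superset_mono) simp
qed

text \<open>The supremum is the limit as \<open>\<epsilon>\<close> decreases to 0.\<close>

lemma tendsto_hausdorff_pre:
  "((\<lambda>\<epsilon>. hausdorff_pre s \<epsilon> A) \<longlongrightarrow> hausdorff s A) (at_right 0)"
proof (rule order_tendstoI)
  fix a assume "a < hausdorff s A"
  then obtain \<delta> where \<delta>: "\<delta> > 0" "a < hausdorff_pre s \<delta> A"
    by (auto simp: hausdorff_def less_SUP_iff)
  have "a < hausdorff_pre s \<epsilon> A" if "\<epsilon> < \<delta>" for \<epsilon>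
    using \<delta>(2) hausdorff_pre_antimono[of \<epsilon> \<delta> s A] that by (meson less_le_trans less_imp_le)
  then show "\<forall>\<^sub>F \<epsilon> in at_right 0. a < hausdorff_pre s \<epsilon> A"
    using \<delta>(1) by (auto simp: eventually_at_right_field)
next
  fix a assume a: "hausdorff s A < a"
  have "hausdorff_pre s \<epsilon> A < a" if "\<epsilon> > 0" for \<epsilon>
    using a that unfolding hausdorff_def by (meson SUP_lessD greaterThan_iff)
  then show "\<forall>\<^sub>F \<epsilon> in at_right 0. hausdorff_pre s \<epsilon> A < a"
    by (auto simp: eventually_at_right_field intro: exI[of _ 1])
qed

end

theory Submission
  imports Defs
begin

text \<open>
  Both parts are instances of one fact: a map that multiplies all distances within a set by
  \<open>c > 0\<close> multiplies its \<open>s\<close>-dimensional Hausdorff measure by \<open>c\<^sup>s\<close>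
  (\<open>hausdorff_similarity_image\<close>). Translations have ratio 1 and dilations have ratio \<open>l\<close>.

  The inequality \<open>\<le>\<close> already holds for every \<open>c\<close>-Lipschitz map
  (\<open>hausdorff_lipschitz_image_le\<close>): such a map carries a cover of the set to a cover of its
  image, and it enlarges each diameter by a factor of at most \<open>c\<close>, hence each term of the sum by at
  most \<open>c\<^sup>s\<close> and the fineness of the cover by at most \<open>c\<close>. The last of these changes disappears
  in the supremum over all scales. A similarity of ratio \<open>c\<close> is \<open>c\<close>-Lipschitz and its inverse is
  \<open>1/c\<close>-Lipschitz, so the inequality for the inverse is the missing \<open>\<ge>\<close>.
\<close>

lemma infsum_cmult_right_ennreal:
  fixes g :: "'b \<Rightarrow> ennreal"
  assumes "k < top"
  shows "(\<Sum>\<^sub>\<infinity>x\<in>S. k * g x) = k * (\<Sum>\<^sub>\<infinity>x\<in>S. g x)"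
proof -
  have "isCont (\<lambda>x. k * x) y" for y :: ennreal
    using assms by (simp add: isCont_def ennreal_tendsto_cmult)
  then have "infsum ((\<lambda>x. k * x) \<circ> g) S = k * infsum g S"
    by (intro infsum_comm_additive_general)
       (auto simp: sum_distrib_left nonneg_summable_on_complete)
  then show ?thesis by (simp add: o_def)
qed

text \<open>
  Different members of a cover may have the same image, and a cover, being a set, then
  counts that image only once; hence an inequality.
\<close>

lemma infsum_image_le_ennreal:
  fixes g :: "'b \<Rightarrow> ennreal"
  shows "(\<Sum>\<^sub>\<infinity>y\<in>h ` S. g y) \<le> (\<Sum>\<^sub>\<infinity>x\<in>S. g (h x))"
proof -
  obtain T where T: "T \<subseteq> S" "inj_on h T" "h ` S = h ` T"
    by (metis subset_image_inj subset_refl)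
  have "(\<Sum>\<^sub>\<infinity>y\<in>h ` S. g y) = (\<Sum>\<^sub>\<infinity>x\<in>T. g (h x))"
    using T by (simp add: infsum_reindex o_def)
  also have "\<dots> \<le> (\<Sum>\<^sub>\<infinity>x\<in>S. g (h x))"
    using T(1) by (intro infsum_mono_neutral) (auto simp: nonneg_summable_on_complete)
  finally show ?thesis .
qed

lemma bounded_lipschitz_image:
  assumes "c-lipschitz_on S f" "bounded S"
  shows "bounded (f ` S)"
  unfolding bounded_two_points
proof (intro exI ballI)
  fix y z assume "y \<in> f ` S" "z \<in> f ` S"
  then obtain a b where ab: "a \<in> S" "b \<in> S" "y = f a" "z = f b" by blast
  then have "dist y z \<le> c * dist a b"
    using lipschitz_onD[OF assms(1)] by simp
  also have "\<dots> \<le> c * diameter S"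
    using ab lipschitz_on_nonneg[OF assms(1)] diameter_bounded_bound[OF assms(2)]
    by (intro mult_left_mono) auto
  finally show "dist y z \<le> c * diameter S" .
qed

lemma diameter_lipschitz_image_le:
  assumes "c-lipschitz_on S f" "bounded S"
  shows "diameter (f ` S) \<le> c * diameter S"
proof (cases "S = {}")
  case False
  have "dist (f x) (f y) \<le> c * diameter S" if "x \<in> S" "y \<in> S" for x y
    using lipschitz_onD[OF assms(1) that] diameter_bounded_bound[OF assms(2) that]
      lipschitz_on_nonneg[OF assms(1)] by (meson mult_left_mono order_trans)
  with False show ?thesis
    by (auto simp: diameter_def intro!: cSUP_least)
qed simp

lemma diam_power_lipschitz_image_le:
  assumes "c-lipschitz_on S f" "bounded S" "c > 0" "s \<ge> 0"
  shows "diam_power s (f ` S) \<le> ennreal (c powr s) * diam_power s S"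
proof (cases "S = {} \<or> s = 0")
  case True
  then show ?thesis using \<open>c > 0\<close> by (auto simp: diam_power_def)
next
  case False
  have "diameter (f ` S) powr s \<le> (c * diameter S) powr s"
    using assms bounded_lipschitz_image[OF assms(1,2)]
    by (intro powr_mono2 diameter_lipschitz_image_le diameter_ge_0)
  also have "\<dots> = c powr s * diameter S powr s"
    using assms by (simp add: powr_mult diameter_ge_0)
  finally show ?thesis
    using False by (simp add: diam_power_def flip: ennreal_mult)
qed

lemma diam_power_mono:
  assumes "S \<subseteq> T" "bounded T" "s \<ge> 0"
  shows "diam_power s S \<le> diam_power s T"
proof -
  have "diameter S powr s \<le> diameter T powr s"
    using assms by (meson bounded_subset diameter_ge_0 diameter_subset powr_mono2)
  with assms(1) show ?thesis
    by (auto simp: diam_power_def)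
qed

text \<open>
  Since the map is controlled on \<open>A\<close> only, a covering set \<open>X\<close> is cut down to
  \<open>X \<inter> A\<close> before taking its image.
\<close>

lemma hausdorff_pre_lipschitz_image_le:
  assumes f: "c-lipschitz_on A f" and "c > 0" "s \<ge> 0" and D: "D \<in> fine_covers \<epsilon> A"
  shows "hausdorff_pre s (c * \<epsilon>) (f ` A) \<le> ennreal (c powr s) * (\<Sum>\<^sub>\<infinity>X\<in>D. diam_power s X)"
proof -
  define h where "h X = f ` (X \<inter> A)" for X
  have lip: "c-lipschitz_on (X \<inter> A) f" for X
    using f by (rule lipschitz_on_subset) simp
  have bdd: "bounded X" and small: "diameter X \<le> \<epsilon>" if "X \<in> D" for X
    using D that by (auto simp: fine_covers_def)
  have bdd': "bounded (X \<inter> A)" if "X \<in> D" for X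
    using bdd[OF that] by (rule bounded_subset) simp
  have "diameter (h X) \<le> c * \<epsilon>" if "X \<in> D" for X
  proof -
    have "diameter (X \<inter> A) \<le> \<epsilon>"
      using diameter_subset[of "X \<inter> A" X] bdd[OF that] small[OF that] by simp
    then have "c * diameter (X \<inter> A) \<le> c * \<epsilon>"
      using \<open>c > 0\<close> by simp
    with diameter_lipschitz_image_le[OF lip bdd'[OF that]] show ?thesis
      by (simp add: h_def)
  qed
  moreover have "bounded (h X)" if "X \<in> D" for X
    using bounded_lipschitz_image[OF lip bdd'[OF that]] by (simp add: h_def)
  ultimately have "h ` D \<in> fine_covers (c * \<epsilon>) (f ` A)"
    using D by (fastforce simp: fine_covers_def h_def)
  then have "hausdorff_pre s (c * \<epsilon>) (f ` A) \<le> (\<Sum>\<^sub>\<infinity>Y\<in>h ` D. diam_power s Y)"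
    unfolding hausdorff_pre_def by (rule INF_lower)
  also have "\<dots> \<le> (\<Sum>\<^sub>\<infinity>X\<in>D. diam_power s (h X))"
    by (rule infsum_image_le_ennreal)
  also have "\<dots> \<le> (\<Sum>\<^sub>\<infinity>X\<in>D. ennreal (c powr s) * diam_power s X)"
  proof (rule infsum_mono)
    fix X assume "X \<in> D"
    have "diam_power s (h X) \<le> ennreal (c powr s) * diam_power s (X \<inter> A)"
      unfolding h_def using lip bdd'[OF \<open>X \<in> D\<close>] assms by (intro diam_power_lipschitz_image_le)
    also have "\<dots> \<le> ennreal (c powr s) * diam_power s X"
      using bdd[OF \<open>X \<in> D\<close>] \<open>s \<ge> 0\<close> by (intro mult_left_mono diam_power_mono) auto
    finally show "diam_power s (h X) \<le> ennreal (c powr s) * diam_power s X" .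
  qed (auto simp: nonneg_summable_on_complete)
  also have "\<dots> = ennreal (c powr s) * (\<Sum>\<^sub>\<infinity>X\<in>D. diam_power s X)"
    by (simp add: infsum_cmult_right_ennreal)
  finally show ?thesis .
qed

lemma ennreal_powr_minus_mult_cancel:
  assumes "c > 0"
  shows "ennreal (c powr s) * (ennreal (c powr - s) * z) = z"
  using assms by (simp add: powr_minus flip: mult.assoc ennreal_mult)

lemma hausdorff_lipschitz_image_le:
  assumes f: "c-lipschitz_on A f" and c: "c > 0" and s: "s \<ge> 0"
  shows "hausdorff s (f ` A) \<le> ennreal (c powr s) * hausdorff s A"
proof -
  let ?u = "ennreal (c powr s)" and ?v = "ennreal (c powr - s)"
  \<comment> \<open>With the inverse factor on the left-hand side, that factor passes through the supremum
    over scales, and the infimum over covers on the right-hand side need not be multiplied.\<close>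
  have "?v * hausdorff_pre s \<delta> (f ` A) \<le> hausdorff s A" if "\<delta> > 0" for \<delta>
  proof -
    have "?v * hausdorff_pre s \<delta> (f ` A) \<le> (\<Sum>\<^sub>\<infinity>X\<in>D. diam_power s X)"
      if "D \<in> fine_covers (\<delta> / c) A" for D
    proof -
      have "hausdorff_pre s \<delta> (f ` A) \<le> ?u * (\<Sum>\<^sub>\<infinity>X\<in>D. diam_power s X)"
        using hausdorff_pre_lipschitz_image_le[OF f c s that] c by simp
      then have "?v * hausdorff_pre s \<delta> (f ` A) \<le> ?v * (?u * (\<Sum>\<^sub>\<infinity>X\<in>D. diam_power s X))"
        by (rule mult_left_mono) simp
      then show ?thesis
        using ennreal_powr_minus_mult_cancel[OF c, of "- s"] by simp
    qed
    then have "?v * hausdorff_pre s \<delta> (f ` A) \<le> hausdorff_pre s (\<delta> / c) A"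
      unfolding hausdorff_pre_def[of s "\<delta> / c"] by (rule INF_greatest)
    also have "\<dots> \<le> hausdorff s A"
      unfolding hausdorff_def using \<open>\<delta> > 0\<close> c by (intro SUP_upper) simp
    finally show ?thesis .
  qed
  then have "?v * hausdorff s (f ` A) \<le> hausdorff s A"
    unfolding hausdorff_def[of s "f ` A"] SUP_mult_left_ennreal by (intro SUP_least) simp
  then have "?u * (?v * hausdorff s (f ` A)) \<le> ?u * hausdorff s A"
    by (rule mult_left_mono) simp
  then show ?thesis
    by (simp add: ennreal_powr_minus_mult_cancel[OF c])
qed

lemma hausdorff_similarity_image:
  assumes f: "\<And>a b. a \<in> A \<Longrightarrow> b \<in> A \<Longrightarrow> dist (f a) (f b) = c * dist a b"
    and c: "c > 0" and s: "s \<ge> 0"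
  shows "hausdorff s (f ` A) = ennreal (c powr s) * hausdorff s A"
proof (rule antisym)
  show "hausdorff s (f ` A) \<le> ennreal (c powr s) * hausdorff s A"
    using f c s by (intro hausdorff_lipschitz_image_le lipschitz_onI) auto
next
  let ?g = "inv_into A f"
  have inj: "inj_on f A"
    using f c by (metis dist_eq_0_iff inj_onI mult_eq_0_iff less_irrefl)
  have "(1 / c)-lipschitz_on (f ` A) ?g"
    using f c inj by (intro lipschitz_onI) auto
  then have "hausdorff s (?g ` f ` A) \<le> ennreal ((1 / c) powr s) * hausdorff s (f ` A)"
    using c s by (intro hausdorff_lipschitz_image_le) auto
  moreover have "?g ` f ` A = A"
    using inj by simp
  moreover have "(1 / c) powr s = c powr - s"
    using c by (simp add: powr_minus powr_divide inverse_eq_divide)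
  ultimately have "hausdorff s A \<le> ennreal (c powr - s) * hausdorff s (f ` A)"
    by simp
  then have "ennreal (c powr s) * hausdorff s A
      \<le> ennreal (c powr s) * (ennreal (c powr - s) * hausdorff s (f ` A))"
    by (rule mult_left_mono) simp
  then show "ennreal (c powr s) * hausdorff s A \<le> hausdorff s (f ` A)"
    by (simp add: ennreal_powr_minus_mult_cancel[OF c])
qed

theorem proposition3:
  shows
    "((\<forall>a b x :: 'a :: {real_vector, metric_space}. dist (a + x) (b + x) = dist a b) \<longrightarrow>
       (\<forall>s\<ge>0. \<forall>(A :: 'a set) x. hausdorff s ((\<lambda>a. a + x) ` A) = hausdorff s A)) \<and>
     ((\<forall>l::real. l > 0 \<longrightarrow> (\<forall>a b :: 'a. dist (l *\<^sub>R a) (l *\<^sub>R b) = l * dist a b)) \<longrightarrow>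
       (\<forall>s\<ge>0. \<forall>A :: 'a set. \<forall>l>0.
          hausdorff s ((\<lambda>a. l *\<^sub>R a) ` A) = ennreal (l powr s) * hausdorff s A))"
proof (intro conjI impI allI)
  fix s :: real and A :: "'a set" and x :: 'a
  assume "\<forall>a b x :: 'a. dist (a + x) (b + x) = dist a b" and "0 \<le> s"
  then show "hausdorff s ((\<lambda>a. a + x) ` A) = hausdorff s A"
    using hausdorff_similarity_image[of A "\<lambda>a. a + x" 1 s] by simp
next
  fix s l :: real and A :: "'a set"
  assume "\<forall>l::real. l > 0 \<longrightarrow> (\<forall>a b :: 'a. dist (l *\<^sub>R a) (l *\<^sub>R b) = l * dist a b)"
    and "0 \<le> s" and "0 < l"
  then show "hausdorff s ((\<lambda>a. l *\<^sub>R a) ` A) = ennreal (l powr s) * hausdorff s A"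
    by (intro hausdorff_similarity_image) auto
qed

end
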